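(* Let $0<q<1$ and let $\nu>-1$ be real with $\nu\notin\{0,1,2,\dots\}$. Let $V:\mathbb{R}_q^+\to\mathbb{R}$ and let $\lambda$ be a non-real complex number. Then there exists a unique (up to a constant factor) nonzero solution $f:\mathbb{R}_q^+\to\mathbb{C}$ of the $q$-difference equation $$\Delta_{q,\nu}f(x)=[V(x)-\lambda]f(x),\qquad x\in\mathbb{R}_q^+,$$ satisfying $$\int_a^\infty|f(x)|^2x^{2\nu+1}d_qx<\infty$$ for some constant $a\in\mathbb{R}_q^+$.
   Context: $\mathbb{R}_q^+=\{q^n:n\in\mathbb{Z}\}$. The $q$-Bessel operator is $$\Delta_{q,\nu}f(x)=\frac{1}{x^2}\Big[f(q^{-1}x)-(1+q^{2\nu})f(x)+q^{2\nu}f(qx)\Big].$$ The Jackson integrals are $\int_0^a f(x)d_qx=(1-q)a\sum_{n=0}^\infty q^nf(aq^n)$ and $\int_0^\infty f(x)d_qx=(1-q)\sum_{n=-\infty}^\infty q^nf(q^n)$; accordingly, for $a\in\mathbb{R}_q^+$, $\int_a^\infty f(x)d_qx=(1-q)\sum_{x\in\mathbb{R}_q^+,\,x>a}x f(x)$. *)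

theory Defs
  imports "HOL-Analysis.Analysis"
begin

text \<open>
  Functions on the lattice \<open>{q^n | n \<in> \<int>}\<close> are represented by total functions on the reals,
  of which only the values on the lattice matter.
\<close>

definition q_lattice :: "real \<Rightarrow> real set" where
  "q_lattice q = range (\<lambda>n::int. q powi n)"

definition q_bessel_op :: "real \<Rightarrow> real \<Rightarrow> (real \<Rightarrow> complex) \<Rightarrow> real \<Rightarrow> complex" where
  "q_bessel_op q \<nu> f x =
     1 / of_real (x ^ 2) *
       (f (inverse q * x) - of_real (1 + q powr (2 * \<nu>)) * f x + of_real (q powr (2 * \<nu>)) * f (q * x))"

text \<open>
  The Jackson integral over \<open>(a, \<infinity>)\<close> of a function that is nonnegative on the lattice, as an extended
  nonnegative real. It is meant for nonnegative integrands only (\<open>ennreal\<close> cuts off negative values);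
  for these the sum always exists, possibly with value \<open>\<infinity>\<close>.
\<close>

definition q_nn_integral_above :: "real \<Rightarrow> real \<Rightarrow> (real \<Rightarrow> real) \<Rightarrow> ennreal" where
  "q_nn_integral_above q a f =
     ennreal (1 - q) * (\<Sum>\<^sub>\<infinity>x\<in>{x \<in> q_lattice q. x > a}. ennreal (x * f x))"

definition q_bessel_solution ::
  "real \<Rightarrow> real \<Rightarrow> (real \<Rightarrow> real) \<Rightarrow> complex \<Rightarrow> (real \<Rightarrow> complex) \<Rightarrow> bool" where
  "q_bessel_solution q \<nu> V z f \<longleftrightarrow>
     (\<forall>x\<in>q_lattice q. q_bessel_op q \<nu> f x = (of_real (V x) - z) * f x)"

definition q_square_integrable_at_infinity :: "real \<Rightarrow> real \<Rightarrow> (real \<Rightarrow> complex) \<Rightarrow> bool" where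
  "q_square_integrable_at_infinity q \<nu> f \<longleftrightarrow>
     (\<exists>a\<in>q_lattice q.
        q_nn_integral_above q a (\<lambda>x. (cmod (f x))\<^sup>2 * x powr (2 * \<nu> + 1)) < \<infinity>)"

end

theory Submission
  imports Defs
begin

text \<open>
  Put \<open>u m = f (q powi (- m))\<close>, so that infinity on the lattice is \<open>m \<longlonglongrightarrow> \<infinity>\<close>. With
  \<open>r = q powr (2 * \<nu>)\<close> the equation becomes the three-term recurrence
  \<open>u (m + 1) = b m * u m - r * u (m - 1)\<close>, where \<open>Im (b m) = - Im z * d ^ m\<close> and \<open>d = 1 / q\<^sup>2\<close>,
  and square integrability becomes summability of \<open>(d / r) ^ k * (cmod (u k))\<^sup>2\<close>
  (\<open>q_bessel_solution_iff_three_term\<close>, \<open>q_square_integrable_iff_summable\<close>). The theorem is then a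
  limit-point statement in the sense of Weyl.

  Uniqueness (\<open>square_summable_casoratian_eq_0\<close>): the Casoratian of two solutions equals \<open>r ^ k\<close> times
  its value at \<open>0\<close>. If both solutions are square summable, the Casoratian multiplied by
  \<open>(d / r) ^ k\<close> tends to \<open>0\<close>; but this product is \<open>d ^ k\<close> times the value at \<open>0\<close>, and \<open>d \<ge> 1\<close>. So the
  Casoratian vanishes and the solutions are proportional. The growth of \<open>d ^ k\<close> leaves no room for
  the limit-circle case, whatever the potential is.

  Existence (\<open>square_summable_solution_exists\<close>): a solution that vanishes at \<open>n\<close> satisfies, by
  Green's identity (\<open>three_term_green\<close>),
  \<open>Im z * (\<Sum>k=1..n. (d / r) ^ k * (cmod (u k))\<^sup>2) = Im (cnj (u 0) * u 1)\<close>. If its initial data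
  are normalised, this bounds the sum independently of \<open>n\<close>, since \<open>Im z \<noteq> 0\<close>. A limit
  of such initial data along a subsequence of \<open>n \<longlonglongrightarrow> \<infinity>\<close> inherits the bound for every partial sum.
\<close>

section \<open>Three-term recurrences on the integers\<close>

definition three_term :: "real \<Rightarrow> (int \<Rightarrow> complex) \<Rightarrow> (int \<Rightarrow> complex) \<Rightarrow> bool" where
  "three_term r b u \<longleftrightarrow> (\<forall>m. u (m + 1) = b m * u m - of_real r * u (m - 1))"

lemma three_termD: "three_term r b u \<Longrightarrow> u (m + 1) = b m * u m - of_real r * u (m - 1)"
  by (simp add: three_term_def)

lemma three_term_linear_combination:
  assumes "three_term r b u" "three_term r b v"
  shows "three_term r b (\<lambda>m. \<alpha> * u m + \<beta> * v m)"
  unfolding three_term_def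
  by (simp add: three_termD[OF assms(1)] three_termD[OF assms(2)] algebra_simps)

lemma three_term_exists:
  assumes "r \<noteq> 0"
  obtains u where "three_term r b u" "u 0 = \<alpha>" "u 1 = \<beta>"
proof -
  \<comment> \<open>\<open>F k\<close> is \<open>(u k, u (k + 1))\<close> and \<open>B k\<close> is \<open>(u (- k), u (1 - k))\<close>.\<close>
  define F where "F = rec_nat (\<alpha>, \<beta>) (\<lambda>k p. (snd p, b (int k + 1) * snd p - of_real r * fst p))"
  define B where "B = rec_nat (\<alpha>, \<beta>) (\<lambda>k p. ((b (- int k) * fst p - snd p) / of_real r, fst p))"
  have F0: "F 0 = (\<alpha>, \<beta>)" and B0: "B 0 = (\<alpha>, \<beta>)"
    and FS: "\<And>k. F (Suc k) = (snd (F k), b (int k + 1) * snd (F k) - of_real r * fst (F k))"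
    and BS: "\<And>k. B (Suc k) = ((b (- int k) * fst (B k) - snd (B k)) / of_real r, fst (B k))"
    by (simp_all add: F_def B_def)
  define u where "u m = (if m \<ge> 0 then fst (F (nat m)) else fst (B (nat (- m))))" for m :: int
  have uF: "u (int k) = fst (F k)" for k
    by (simp add: u_def)
  have uB: "u (- int k) = fst (B k)" for k
    by (cases "k = 0") (simp_all add: u_def F0 B0)
  have u1: "u 1 = \<beta>"
    using uF[of 1] FS[of 0] F0 by simp
  have "u (m + 1) = b m * u m - of_real r * u (m - 1)" for m
  proof (cases "m > 0")
    case True
    then obtain k where k: "m = int (Suc k)"
      by (auto intro: that[of "nat (m - 1)"])
    have "u (m + 1) = fst (F (Suc (Suc k)))" "u m = fst (F (Suc k))" "u (m - 1) = fst (F k)"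
      using uF[of "Suc (Suc k)"] uF[of "Suc k"] uF[of k] k by (simp_all add: algebra_simps)
    then show ?thesis
      using k by (simp add: FS algebra_simps)
  next
    case False
    then obtain k where k: "m = - int k"
      by (auto intro: that[of "nat (- m)"])
    have "u (m + 1) = snd (B k)"
    proof (cases k)
      case 0
      then show ?thesis using k u1 B0 by simp
    next
      case (Suc j)
      then show ?thesis using uB[of j] k by (simp add: BS)
    qed
    moreover have "u m = fst (B k)" "u (m - 1) = fst (B (Suc k))"
      using uB[of k] uB[of "Suc k"] k by (simp_all add: minus_diff_commute)
    ultimately show ?thesis
      using k assms by (simp add: BS)
  qed
  moreover have "u 0 = \<alpha>"
    using uF[of 0] F0 by simp
  ultimately show ?thesis
    using that[of u] u1 by (simp add: three_term_def)
qed

text \<open>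
  As \<open>r \<noteq> 0\<close>, the recurrence runs in both directions, so two neighbouring values determine a solution.
\<close>
lemma three_term_eq_0:
  assumes "three_term r b u" "r \<noteq> 0" "u 0 = 0" "u 1 = 0"
  shows "u m = 0"
proof -
  have "u m = 0 \<and> u (m + 1) = 0"
  proof (induction m rule: int_induct[where k = 0])
    case base
    then show ?case using assms by simp
  next
    case (step1 i)
    then show ?case using three_termD[OF assms(1), of "i + 1"] by simp
  next
    case (step2 i)
    then have "of_real r * u (i - 1) = 0"
      using three_termD[OF assms(1), of i] by (auto simp: eq_neg_iff_add_eq_0 minus_equation_iff)
    then show ?case using step2 assms(2) by simp
  qed
  then show ?thesis by simp
qed

lemma three_term_casoratian:
  assumes "three_term r b u" "three_term r b v"
  shows "u (int k + 1) * v (int k) - u (int k) * v (int k + 1)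
       = of_real (r ^ k) * (u 1 * v 0 - u 0 * v 1)"
proof (induction k)
  case 0
  then show ?case by simp
next
  case (Suc k)
  have "u (int (Suc k) + 1) * v (int (Suc k)) - u (int (Suc k)) * v (int (Suc k) + 1)
      = of_real r * (u (int k + 1) * v (int k) - u (int k) * v (int k + 1))"
  proof -
    have k: "int (Suc k) = int k + 1" "int k + 1 - 1 = int k"
      by simp_all
    show ?thesis
      unfolding k(1) three_termD[OF assms(1), of "int k + 1"] three_termD[OF assms(2), of "int k + 1"] k(2)
      by (simp add: algebra_simps)
  qed
  also have "\<dots> = of_real (r ^ Suc k) * (u 1 * v 0 - u 0 * v 1)"
    by (simp only: Suc.IH) simp
  finally show ?case .
qed

section \<open>Limit point: uniqueness of the square-summable solution\<close>

text \<open>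
  The weighted Casoratian at \<open>k\<close> involves the values at \<open>k\<close> and \<open>k + 1\<close>. Consecutive weights differ only by
  the fixed factor \<open>d / r\<close>, so it is dominated by the terms of the two convergent series at \<open>k\<close> and \<open>k + 1\<close>.
\<close>
lemma square_summable_casoratian_eq_0:
  assumes u: "three_term r b u" and v: "three_term r b v"
    and r: "r > 0" and d: "d \<ge> 1"
    and su: "summable (\<lambda>k. (d / r) ^ k * (cmod (u (int k)))\<^sup>2)"
    and sv: "summable (\<lambda>k. (d / r) ^ k * (cmod (v (int k)))\<^sup>2)"
  shows "u 1 * v 0 = u 0 * v 1"
proof -
  define w where "w = cmod (u 1 * v 0 - u 0 * v 1)"
  define S where "S k = (d / r) ^ k * (cmod (u (int k)))\<^sup>2 + (d / r) ^ k * (cmod (v (int k)))\<^sup>2" for k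
  have S0: "S \<longlonglongrightarrow> 0"
    unfolding S_def using tendsto_add[OF summable_LIMSEQ_zero[OF su] summable_LIMSEQ_zero[OF sv]] by simp
  have "w \<le> S k + r / d * S (Suc k)" for k
  proof -
    let ?p = "(d / r) ^ k"
    let ?U = "cmod (u (int k))" and ?U' = "cmod (u (int k + 1))"
    let ?V = "cmod (v (int k))" and ?V' = "cmod (v (int k + 1))"
    \<comment> \<open>The factor \<open>d ^ k = (d / r) ^ k * r ^ k\<close> is the weight times the growth of the Casoratian.\<close>
    have "w \<le> d ^ k * w"
      using d one_le_power[of d k] mult_right_mono[of 1 "d ^ k" w] by (simp add: w_def)
    also have "\<dots> = ?p * (r ^ k * w)"
      using r by (simp add: power_divide)
    also have "r ^ k * w = cmod (u (int k + 1) * v (int k) - u (int k) * v (int k + 1))"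
      unfolding three_term_casoratian[OF u v] w_def using r by (simp add: norm_mult norm_power)
    also have "\<dots> \<le> ?U' * ?V + ?U * ?V'"
      by (metis norm_mult norm_triangle_ineq4)
    also have "\<dots> \<le> (?U\<^sup>2 + ?V\<^sup>2) + (?U'\<^sup>2 + ?V'\<^sup>2)"
      using sum_squares_bound[of ?U' ?V] sum_squares_bound[of ?U ?V'] 
        zero_le_power2[of ?U] zero_le_power2[of ?U'] zero_le_power2[of ?V] zero_le_power2[of ?V']
      by linarith
    finally have "w \<le> ?p * ((?U\<^sup>2 + ?V\<^sup>2) + (?U'\<^sup>2 + ?V'\<^sup>2))"
      using r d by (simp add: mult_left_mono)
    also have "\<dots> = S k + r / d * S (Suc k)"
      using r d by (simp add: S_def field_simps add.commute)
    finally show ?thesis .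
  qed
  moreover have "(\<lambda>k. S k + r / d * S (Suc k)) \<longlonglongrightarrow> 0 + r / d * 0"
    by (intro tendsto_intros S0 LIMSEQ_Suc[OF S0])
  ultimately have "w \<le> 0"
    by (intro LIMSEQ_le_const[where X = "\<lambda>k. S k + r / d * S (Suc k)"]) auto
  then show ?thesis
    by (simp add: w_def)
qed

lemma square_summable_proportional:
  assumes u: "three_term r b u" and v: "three_term r b v"
    and r: "r > 0" and d: "d \<ge> 1"
    and su: "summable (\<lambda>k. (d / r) ^ k * (cmod (u (int k)))\<^sup>2)"
    and sv: "summable (\<lambda>k. (d / r) ^ k * (cmod (v (int k)))\<^sup>2)"
    and u_nz: "u i \<noteq> 0" and v_nz: "v j \<noteq> 0"
  obtains c where "c \<noteq> 0" "\<And>m. v m = c * u m"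
proof -
  have W: "u 1 * v 0 = u 0 * v 1"
    by (rule square_summable_casoratian_eq_0[OF u v r d su sv])
  have nz: "u 0 \<noteq> 0 \<or> u 1 \<noteq> 0"
    using three_term_eq_0[OF u, of i] r u_nz by auto
  obtain c where c: "v 0 = c * u 0" "v 1 = c * u 1"
  proof (cases "u 0 = 0")
    case True
    then show ?thesis using that[of "v 1 / u 1"] nz W by simp
  next
    case False
    then show ?thesis using that[of "v 0 / u 0"] W by (simp add: field_simps)
  qed
  have "three_term r b (\<lambda>m. 1 * v m + (- c) * u m)"
    by (rule three_term_linear_combination[OF v u])
  from three_term_eq_0[OF this] r c have "v m = c * u m" for m
    by simp
  with v_nz show ?thesis
    using that[of c] by fastforce
qed

section \<open>Existence of a square-summable solution\<close>

text \<open>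
  Multiply the recurrence by \<open>cnj (u m)\<close> and take imaginary parts: the real part of \<open>b\<close> drops out, and the flux
  \<open>Im (cnj (u m) * u (m + 1)) / r ^ m\<close> changes at each step by exactly the weighted square times \<open>- y\<close>.
\<close>
lemma three_term_green:
  assumes u: "three_term r b u" and r: "r > 0"
    and b: "\<And>k::nat. k > 0 \<Longrightarrow> Im (b (int k)) = - y * d ^ k"
  shows "y * (\<Sum>k=1..n. (d / r) ^ k * (cmod (u (int k)))\<^sup>2)
       = Im (cnj (u 0) * u 1) - Im (cnj (u (int n)) * u (int n + 1)) / r ^ n"
proof (induction n)
  case 0
  then show ?case by simp
next
  case (Suc n)
  let ?m = "int n + 1"
  have "cnj (u ?m) * u (?m + 1) = b ?m * of_real ((cmod (u ?m))\<^sup>2) - of_real r * (cnj (u ?m) * u (int n))"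
    unfolding three_termD[OF u] complex_norm_square by (simp add: algebra_simps)
  moreover have "Im (B * of_real A - of_real r * (cnj X * Y)) = Im B * A + r * Im (cnj Y * X)"
    for A :: real and B X Y :: complex
    by (simp add: algebra_simps)
  ultimately have "Im (cnj (u ?m) * u (?m + 1))
      = Im (b ?m) * (cmod (u ?m))\<^sup>2 + r * Im (cnj (u (int n)) * u ?m)"
    by (simp only:)
  also have "Im (b ?m) = - y * d ^ Suc n"
    using b[of "Suc n"] by (simp add: add.commute)
  finally have "Im (cnj (u ?m) * u (?m + 1)) / r ^ Suc n
      = - y * ((d / r) ^ Suc n * (cmod (u ?m))\<^sup>2) + Im (cnj (u (int n)) * u ?m) / r ^ n"
    using r by (simp add: divide_simps power_divide del: times_complex.sel cnj.sel)
  then show ?case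
    using Suc.IH by (simp add: algebra_simps)
qed

text \<open>
  This replaces Weyl's nested discs by compactness: the initial data of the solutions with a zero at \<open>n\<close> lie on
  the unit sphere of \<open>\<complex>\<^sup>2\<close>, and the solution started from any accumulation point of them is square summable.
\<close>
lemma square_summable_solution_exists:
  assumes r: "r > 0" and d: "d > 0" and y: "y \<noteq> 0"
    and b: "\<And>k::nat. k > 0 \<Longrightarrow> Im (b (int k)) = - y * d ^ k"
  obtains u where "three_term r b u" "u 0 \<noteq> 0 \<or> u 1 \<noteq> 0"
    "summable (\<lambda>k. (d / r) ^ k * (cmod (u (int k)))\<^sup>2)"
proof -
  obtain \<phi> where \<phi>: "three_term r b \<phi>" "\<phi> 0 = 1" "\<phi> 1 = 0"
    using three_term_exists[of r b 1 0] r by auto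
  obtain \<psi> where \<psi>: "three_term r b \<psi>" "\<psi> 0 = 0" "\<psi> 1 = 1"
    using three_term_exists[of r b 0 1] r by auto
  define u where "u p m = fst p * \<phi> m + snd p * \<psi> m" for p :: "complex \<times> complex" and m
  have u: "three_term r b (u p)" for p
    unfolding u_def by (rule three_term_linear_combination[OF \<phi>(1) \<psi>(1)])
  have u0: "u p 0 = fst p" and u1: "u p 1 = snd p" for p
    by (simp_all add: u_def \<phi> \<psi>)
  define E where "E n p = (\<Sum>k=1..n. (d / r) ^ k * (cmod (u p (int k)))\<^sup>2)" for n p
  have E_mono: "E n p \<le> E n' p" if "n \<le> n'" for n n' p
    unfolding E_def using that r d by (intro sum_mono2) auto
  have "\<exists>p. norm p = 1 \<and> u p (int n) = 0" for n
  proof (cases "(\<psi> (int n), \<phi> (int n)) = 0")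
    case True
    \<comment> \<open>In this case every solution vanishes at \<open>n\<close>, and any unit vector serves.\<close>
    then show ?thesis
      by (intro exI[of _ "(1, 0)"]) (simp add: u_def zero_prod_def)
  next
    case False
    let ?p = "(\<psi> (int n), - \<phi> (int n))"
    have "?p \<noteq> 0"
      using False by (simp add: zero_prod_def)
    then show ?thesis
      by (intro exI[of _ "?p /\<^sub>R norm ?p"] conjI) (simp del: scaleR_Pair norm_Pair, simp add: u_def)
  qed
  \<comment> \<open>\<open>P n\<close> are normalised initial data of a solution that vanishes at \<open>n\<close>.\<close>
  then obtain P where P: "\<And>n. norm (P n) = 1" "\<And>n. u (P n) (int n) = 0"
    by metis
  have E_P: "E n (P n) \<le> 1 / \<bar>y\<bar>" for n
  proof -
    have "E n (P n) \<ge> 0"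
      unfolding E_def using r d by (intro sum_nonneg) auto
    then have "\<bar>y\<bar> * E n (P n) = \<bar>y * E n (P n)\<bar>"
      by (simp add: abs_mult)
    also have "y * E n (P n) = Im (cnj (fst (P n)) * snd (P n))"
      using three_term_green[OF u[of "P n"] r, of y d n] b by (simp add: E_def u0 u1 P)
    also have "\<bar>\<dots>\<bar> \<le> cmod (fst (P n)) * cmod (snd (P n))"
      by (metis abs_Im_le_cmod norm_mult complex_mod_cnj)
    also have "\<dots> \<le> 1 * 1"
      using norm_fst_le[of "fst (P n)" "snd (P n)"] norm_snd_le[of "snd (P n)" "fst (P n)"] P(1)[of n]
      by (intro mult_mono) auto
    finally show ?thesis
      using y by (simp add: field_simps)
  qed
  have "seq_compact (sphere (0 :: complex \<times> complex) 1)"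
    by (rule compact_imp_seq_compact) simp
  moreover have "\<forall>n. P n \<in> sphere 0 1"
    using P(1) by simp
  ultimately obtain p \<sigma> where "p \<in> sphere 0 1"
      and \<sigma>: "strict_mono \<sigma>" and lim: "(P \<circ> \<sigma>) \<longlonglongrightarrow> p"
    by (meson seq_compactE)
  then have p: "norm p = 1"
    by simp
  have E_p: "E n p \<le> 1 / \<bar>y\<bar>" for n
  proof (rule LIMSEQ_le_const2)
    show "(\<lambda>i. E n ((P \<circ> \<sigma>) i)) \<longlonglongrightarrow> E n p"
      unfolding E_def u_def by (intro tendsto_intros lim)
    show "\<exists>N. \<forall>i\<ge>N. E n ((P \<circ> \<sigma>) i) \<le> 1 / \<bar>y\<bar>"
    proof (intro exI allI impI)
      fix i assume "n \<le> i"
      also have "i \<le> \<sigma> i"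
        by (rule seq_suble[OF \<sigma>])
      finally show "E n ((P \<circ> \<sigma>) i) \<le> 1 / \<bar>y\<bar>"
        using order_trans[OF E_mono E_P] by simp
    qed
  qed
  \<comment> \<open>The sums \<open>E n p\<close> start at \<open>1\<close>, hence the shift.\<close>
  have "summable (\<lambda>k. (d / r) ^ Suc k * (cmod (u p (int (Suc k))))\<^sup>2)"
  proof (rule summableI_nonneg_bounded)
    show "0 \<le> (d / r) ^ Suc k * (cmod (u p (int (Suc k))))\<^sup>2" for k
      using r d by simp
    have "(\<Sum>k<n. (d / r) ^ Suc k * (cmod (u p (int (Suc k))))\<^sup>2) = E n p" for n
      unfolding E_def by (rule sum.reindex_bij_witness[of _ "\<lambda>k. k - 1" Suc]) auto
    then show "(\<Sum>k<n. (d / r) ^ Suc k * (cmod (u p (int (Suc k))))\<^sup>2) \<le> 1 / \<bar>y\<bar>" for n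
      using E_p by simp
  qed
  then have "summable (\<lambda>k. (d / r) ^ k * (cmod (u p (int k)))\<^sup>2)"
    by (subst (asm) summable_Suc_iff)
  moreover have "u p 0 \<noteq> 0 \<or> u p 1 \<noteq> 0"
    using p unfolding u0 u1 by (cases p) auto
  ultimately show ?thesis
    using that u by blast
qed

section \<open>The lattice as the integers\<close>
lemma inj_powi:
  assumes "0 < q" "q < (1::real)"
  shows "inj (\<lambda>m. q powi (- m))"
proof (rule linorder_injI)
  fix m n :: int assume "m < n"
  then show "q powi (- m) \<noteq> q powi (- n)"
    using power_int_strict_decreasing[of "- n" "- m" q] assms by simp
qed

lemma q_lattice_eq: "q_lattice q = range (\<lambda>m. q powi (- m))"
proof -
  have "q powi m \<in> range (\<lambda>m. q powi (- m))" for m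
    by (rule range_eqI[of _ _ "- m"]) simp
  then show ?thesis
    unfolding q_lattice_def by auto
qed

lemma ball_q_lattice: "(\<forall>x\<in>q_lattice q. P x) \<longleftrightarrow> (\<forall>m. P (q powi (- m)))"
  by (simp add: q_lattice_eq)

lemma bex_q_lattice: "(\<exists>x\<in>q_lattice q. P x) \<longleftrightarrow> (\<exists>m. P (q powi (- m)))"
  by (simp add: q_lattice_eq)

definition q_bessel_coeff :: "real \<Rightarrow> real \<Rightarrow> (real \<Rightarrow> real) \<Rightarrow> complex \<Rightarrow> int \<Rightarrow> complex" where
  "q_bessel_coeff q \<nu> V z m =
     of_real (1 + q powr (2 * \<nu>)) + of_real ((q powi (- m))\<^sup>2) * (of_real (V (q powi (- m))) - z)"

lemma q_bessel_solution_iff_three_term: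
  assumes "0 < q"
  shows "q_bessel_solution q \<nu> V z f \<longleftrightarrow>
    three_term (q powr (2 * \<nu>)) (q_bessel_coeff q \<nu> V z) (\<lambda>m. f (q powi (- m)))"
  unfolding q_bessel_solution_def ball_q_lattice three_term_def
proof (rule all_cong1)
  fix m :: int
  let ?x = "q powi (- m)"
  have "inverse q * ?x = q powi (- (m + 1))" "q * ?x = q powi (- (m - 1))"
    using assms by (simp_all add: power_int_minus power_int_add power_int_diff field_simps)
  then have "q_bessel_op q \<nu> f ?x = 1 / of_real (?x\<^sup>2) *
      (f (q powi (- (m + 1))) - of_real (1 + q powr (2 * \<nu>)) * f ?x
        + of_real (q powr (2 * \<nu>)) * f (q powi (- (m - 1))))"
    by (simp only: q_bessel_op_def)
  moreover have "complex_of_real (?x\<^sup>2) \<noteq> 0"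
    using assms by simp
  moreover have "1 / X * (A - C * F + R * B) = W * F \<longleftrightarrow> A = (C + X * W) * F - R * B"
    if "X \<noteq> 0" for X A C F R B W :: complex
    using that by (auto simp: field_simps)
  ultimately show "q_bessel_op q \<nu> f ?x = (of_real (V ?x) - z) * f ?x \<longleftrightarrow>
      f (q powi (- (m + 1))) = q_bessel_coeff q \<nu> V z m * f ?x
        - of_real (q powr (2 * \<nu>)) * f (q powi (- (m - 1)))"
    unfolding q_bessel_coeff_def by (simp only:) 
qed

lemma Im_q_bessel_coeff:
  "Im (q_bessel_coeff q \<nu> V z (int k)) = - Im z * (1 / q\<^sup>2) ^ k"
proof -
  have "(q powi (- int k))\<^sup>2 = (1 / q\<^sup>2) ^ k"
    by (simp add: power_int_minus power_one_over field_simps flip: power_mult)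
  then show ?thesis
    by (simp add: q_bessel_coeff_def)
qed

text \<open>
  The weight in the Jackson integral is \<open>x * x powr (2 * \<nu> + 1) = x powr (2 * \<nu> + 2)\<close>, where the extra factor
  \<open>x\<close> is the step of the lattice; at \<open>x = q powi (- k)\<close> this is geometric in \<open>k\<close>.
\<close>
lemma q_weight_eq:
  fixes q \<nu> :: real
  assumes "0 < q"
  shows "q powi (- int k) * (A * (q powi (- int k)) powr (2 * \<nu> + 1))
       = ((1 / q\<^sup>2) / q powr (2 * \<nu>)) ^ k * A"
proof -
  have "q powi (- int k) * (q powi (- int k)) powr (2 * \<nu> + 1) = (q powi (- int k)) powr (2 * \<nu> + 2)"
    using assms powr_mult_base[of "q powi (- int k)" "2 * \<nu> + 1"] by (simp add: add.commute)
  also have "\<dots> = (q powr (- real k)) powr (2 * \<nu> + 2)"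
    using assms powr_real_of_int'[of q "- int k"] by simp
  also have "\<dots> = (q powr (- (2 * \<nu> + 2))) powr real k"
    by (simp add: powr_powr algebra_simps)
  also have "\<dots> = (q powr (- (2 * \<nu> + 2))) ^ k"
    using assms by (simp add: powr_realpow)
  also have "q powr (- (2 * \<nu> + 2)) = (1 / q\<^sup>2) / q powr (2 * \<nu>)"
    unfolding powr_minus powr_add using assms by (simp add: field_simps)
  finally show ?thesis
    by (simp add: algebra_simps)
qed

lemma infsum_nat_ennreal_finite_iff:
  fixes h :: "nat \<Rightarrow> real"
  assumes "\<And>k. h k \<ge> 0"
  shows "(\<Sum>\<^sub>\<infinity>k. ennreal (h k)) < \<infinity> \<longleftrightarrow> summable h"
proof -
  have "(\<lambda>k. ennreal (h k)) sums (\<Sum>\<^sub>\<infinity>k. ennreal (h k))"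
    by (intro has_sum_imp_sums has_sum_infsum nonneg_summable_on_complete) simp
  then have "(\<Sum>\<^sub>\<infinity>k. ennreal (h k)) = (\<Sum>k. ennreal (h k))"
    by (rule sums_unique)
  moreover have "(\<Sum>k. ennreal (h k)) \<noteq> top \<longleftrightarrow> summable h"
  proof
    show "summable h" if "(\<Sum>k. ennreal (h k)) \<noteq> top"
      by (rule summable_suminf_not_top[of h, OF assms that])
    show "(\<Sum>k. ennreal (h k)) \<noteq> top" if "summable h"
      by (rule ennreal_suminf_neq_top[of h, OF that assms])
  qed
  ultimately show ?thesis
    by (simp only: infinity_ennreal_def less_top[symmetric])
qed

lemma q_nn_integral_above_eq:
  assumes "0 < q" "q < 1"
  shows "q_nn_integral_above q (q powi (- int n)) g =
    ennreal (1 - q) * (\<Sum>\<^sub>\<infinity>k. ennreal (q powi (- int (Suc n + k)) * g (q powi (- int (Suc n + k)))))"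
proof -
  let ?e = "\<lambda>k::nat. q powi (- int (Suc n + k))"
  have "inj ?e"
    by (intro injI) (auto dest!: injD[OF inj_powi[OF assms]] simp del: minus_add_distrib)
  moreover have "{x \<in> q_lattice q. x > q powi (- int n)} = range ?e"
  proof -
    have "q powi (- m) > q powi (- int n) \<longleftrightarrow> m > int n" for m
      using power_int_strict_decreasing[of "- m" "- int n" q]
        power_int_decreasing[of "- int n" "- m" q] assms by (cases "m > int n") auto
    moreover have "m > int n \<longleftrightarrow> (\<exists>k. m = int (Suc n + k))" for m
      by (auto simp: zless_iff_Suc_zadd algebra_simps)
    ultimately have "{x \<in> q_lattice q. x > q powi (- int n)} = (\<lambda>m. q powi (- m)) ` range (\<lambda>k. int (Suc n + k))"
      unfolding q_lattice_eq by blast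
    then show ?thesis
      by (simp only: image_image)
  qed
  ultimately show ?thesis
    unfolding q_nn_integral_above_def by (simp add: infsum_reindex o_def)
qed

text \<open>
  Convergence does not depend on the lower limit of integration: for \<open>a = q powi (- n)\<close> with \<open>n \<ge> 0\<close> the
  integral is a tail of the series, and for \<open>a < 1\<close> it dominates the integral over \<open>(1, \<infinity>)\<close>.
\<close>
lemma q_square_integrable_iff_summable:
  assumes q: "0 < q" "q < 1"
  shows "q_square_integrable_at_infinity q \<nu> f \<longleftrightarrow>
    summable (\<lambda>k. ((1 / q\<^sup>2) / q powr (2 * \<nu>)) ^ k * (cmod (f (q powi (- int k))))\<^sup>2)"
    (is "_ \<longleftrightarrow> summable ?h")
proof -
  let ?g = "\<lambda>x. (cmod (f x))\<^sup>2 * x powr (2 * \<nu> + 1)"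
  have tail: "q_nn_integral_above q (q powi (- int n)) ?g < \<infinity> \<longleftrightarrow> summable ?h" for n
  proof -
    have "q_nn_integral_above q (q powi (- int n)) ?g
        = ennreal (1 - q) * (\<Sum>\<^sub>\<infinity>k. ennreal (?h (Suc n + k)))"
      unfolding q_nn_integral_above_eq[OF q] q_weight_eq[OF q(1)] ..
    moreover have "(\<Sum>\<^sub>\<infinity>k. ennreal (?h (Suc n + k))) < \<infinity> \<longleftrightarrow> summable (\<lambda>k. ?h (Suc n + k))"
      using q by (intro infsum_nat_ennreal_finite_iff) simp
    moreover have "summable (\<lambda>k. ?h (Suc n + k)) \<longleftrightarrow> summable ?h"
      using summable_iff_shift[of ?h "Suc n"] by (simp add: add.commute)
    ultimately show ?thesis
      using q by (auto simp: ennreal_mult_less_top ennreal_mult_eq_top_iff simp flip: less_top)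
  qed
  have "q_nn_integral_above q (q powi (- int (nat m))) ?g \<le> q_nn_integral_above q (q powi (- m)) ?g" for m
  proof -
    have "q powi (- m) \<le> q powi (- int (nat m))"
      using q by (intro power_int_decreasing) auto
    then show ?thesis
      unfolding q_nn_integral_above_def
      by (intro mult_left_mono infsum_mono_neutral nonneg_summable_on_complete) auto
  qed
  then have "summable ?h" if "q_nn_integral_above q (q powi (- m)) ?g < \<infinity>" for m
    using that tail[of "nat m"] by (blast intro: order.strict_trans1)
  then show ?thesis
    unfolding q_square_integrable_at_infinity_def bex_q_lattice
    using tail[of 0] by blast
qed

theorem theorem3:
  fixes q \<nu> :: real and V :: "real \<Rightarrow> real" and z :: complex
  assumes "0 < q" and "q < 1"
    and "\<nu> > -1" and "\<nu> \<notin> \<nat>"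
    and "z \<notin> \<real>"
  shows "\<exists>f :: real \<Rightarrow> complex.
           (\<exists>x\<in>q_lattice q. f x \<noteq> 0) \<and>
           q_bessel_solution q \<nu> V z f \<and>
           q_square_integrable_at_infinity q \<nu> f \<and>
           (\<forall>g :: real \<Rightarrow> complex.
              (\<exists>x\<in>q_lattice q. g x \<noteq> 0) \<and>
              q_bessel_solution q \<nu> V z g \<and>
              q_square_integrable_at_infinity q \<nu> g \<longrightarrow>
              (\<exists>c. c \<noteq> 0 \<and> (\<forall>x\<in>q_lattice q. g x = c * f x)))"
proof -
  let ?r = "q powr (2 * \<nu>)" and ?d = "1 / q\<^sup>2" and ?b = "q_bessel_coeff q \<nu> V z"
  have r: "?r > 0" and d: "?d \<ge> 1"
    using assms(1,2) by (simp_all add: power_le_one)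
  have "Im z \<noteq> 0"
    using assms(5) by (simp add: complex_is_Real_iff)
  then obtain u where u: "three_term ?r ?b u" "u 0 \<noteq> 0 \<or> u 1 \<noteq> 0"
      and su: "summable (\<lambda>k. (?d / ?r) ^ k * (cmod (u (int k)))\<^sup>2)"
    using square_summable_solution_exists[of ?r ?d "Im z" ?b] r d Im_q_bessel_coeff
    by auto
  obtain i where i: "u i \<noteq> 0"
    using u(2) by blast
  define f where "f = u \<circ> inv (\<lambda>m. q powi (- m))"
  have f: "f (q powi (- m)) = u m" for m
    by (simp add: f_def inv_f_f[OF inj_powi[OF assms(1,2)]])
  have unique: "\<exists>c. c \<noteq> 0 \<and> (\<forall>x\<in>q_lattice q. g x = c * f x)"
    if nz: "\<exists>x\<in>q_lattice q. g x \<noteq> 0" and sol: "q_bessel_solution q \<nu> V z g"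
      and int: "q_square_integrable_at_infinity q \<nu> g" for g
  proof -
    obtain j where "g (q powi (- j)) \<noteq> 0"
      using nz unfolding bex_q_lattice by blast
    then obtain c where "c \<noteq> 0" "\<And>m. g (q powi (- m)) = c * u m"
      using square_summable_proportional[OF u(1)
          sol[unfolded q_bessel_solution_iff_three_term[OF assms(1)]] r d su
          int[unfolded q_square_integrable_iff_summable[OF assms(1,2)]] i]
      by blast
    then show ?thesis
      unfolding ball_q_lattice f by blast
  qed
  show ?thesis
  proof (intro exI[of _ f] conjI allI impI)
    show "\<exists>x\<in>q_lattice q. f x \<noteq> 0"
      unfolding bex_q_lattice f using i by blast
    show "q_bessel_solution q \<nu> V z f"
      unfolding q_bessel_solution_iff_three_term[OF assms(1)] f by (rule u(1))
    show "q_square_integrable_at_infinity q \<nu> f"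
      unfolding q_square_integrable_iff_summable[OF assms(1,2)] f by (rule su)
  qed (use unique in blast)
qed

end
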